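(* Let $K,C\subset\mathbb{R}^d$ be convex bodies. Then $$\frac{R(K,C)}{r(K,C)} \ge \max\left\{\frac{s(K)}{s(C)},\ \frac{s(C)}{s(K)}\right\}.$$ This bound is best possible in the sense that for every $\sigma_K,\sigma_C\in[1,d]$ there exist convex bodies $K,C\subset\mathbb{R}^d$ with $s(K)=\sigma_K$ and $s(C)=\sigma_C$ for which the inequality holds with equality.
   Context: A convex body in $\mathbb{R}^d$ is a non-empty compact convex set (not necessarily full-dimensional, not necessarily symmetric). For non-empty closed convex $K,C\subset\mathbb{R}^d$: - $C$-radius: $R(K,C) := \inf\{\rho\ge 0 : \exists c\in\mathbb{R}^d \text{ such that } K\subset c+\rho C\}\in[0,\infty]$ (with $\inf\emptyset=\infty$). - $C$-inradius: $r(K,C) := \sup\{\rho\ge 0 : \exists c\in\mathbb{R}^d \text{ such that } c+\rho C\subset K\}$. - Minkowski asymmetry: $s(K) := R(-K,K)$, where $-K=\{-x:x\in K\}$. The ratio $\alpha/\beta$ of extended reals is $\infty$ if $\beta=0$ and $\alpha>0$, or if $\alpha=\infty$ and $\beta<\infty$; ratios of the form $0/0$ or $\infty/\infty$ are taken to be $1$.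
   Formalization: The inequality is stated only for convex bodies K and C that are not single points; with a single point it fails under the given conventions (e.g. K a point, C not: R/r = 0/0 = 1 but s(C)/s(K) = ∞). *)

theory Defs
  imports "HOL-Analysis.Analysis"
begin

definition convex_body :: "'a::euclidean_space set \<Rightarrow> bool" where
  "convex_body K \<longleftrightarrow> K \<noteq> {} \<and> compact K \<and> convex K"

text \<open>The infimum of the empty set is \<open>\<infinity>\<close> in \<^typ>\<open>ennreal\<close>.\<close>

definition circumradius :: "'a::euclidean_space set \<Rightarrow> 'a set \<Rightarrow> ennreal" where
  "circumradius K C =
     Inf {ennreal \<rho> | \<rho>. 0 \<le> \<rho> \<and> (\<exists>c. K \<subseteq> (\<lambda>x. c + \<rho> *\<^sub>R x) ` C)}"

definition inradius :: "'a::euclidean_space set \<Rightarrow> 'a set \<Rightarrow> ennreal" where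
  "inradius K C =
     Sup {ennreal \<rho> | \<rho>. 0 \<le> \<rho> \<and> (\<exists>c. (\<lambda>x. c + \<rho> *\<^sub>R x) ` C \<subseteq> K)}"

text \<open>A single point has asymmetry \<open>0\<close>, since \<open>\<rho> = 0\<close> is admissible.\<close>

definition minkowski_asymmetry :: "'a::euclidean_space set \<Rightarrow> ennreal" where
  "minkowski_asymmetry K = circumradius (uminus ` K) K"

text \<open>Division on \<^typ>\<open>ennreal\<close> gives \<open>\<infinity>\<close> for \<open>\<alpha> / 0\<close> with \<open>\<alpha> > 0\<close> and for \<open>\<infinity> / \<beta>\<close> with
  \<open>\<beta> < \<infinity>\<close>, but it gives \<open>0\<close> for \<open>0 / 0\<close> and \<open>\<infinity> / \<infinity>\<close>, which are taken to be \<open>1\<close> here.\<close>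

definition ext_ratio :: "ennreal \<Rightarrow> ennreal \<Rightarrow> ennreal" where
  "ext_ratio \<alpha> \<beta> =
     (if (\<alpha> = 0 \<and> \<beta> = 0) \<or> (\<alpha> = \<infinity> \<and> \<beta> = \<infinity>) then 1 else \<alpha> / \<beta>)"

end

theory Submission
  imports Defs
begin

text \<open>
  Write \<open>R(K, C)\<close> for the circumradius. Composing homothetic coverings gives
  \<open>R(A, C) \<le> R(A, B) R(B, C)\<close> (\<open>circumradius_submult\<close>), and reading an inclusion
  \<open>c + \<rho> C \<subseteq> K\<close> backwards shows that the inradius of \<open>K\<close> with respect to \<open>C\<close> is
  \<open>1 / R(C, K)\<close> (\<open>inradius_eq_inverse_circumradius\<close>). So the radius ratio is the symmetric
  quantity \<open>R(K, C) R(C, K)\<close>, a multiplicative distance between \<open>K\<close> and \<open>C\<close> up to homothety.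
  The inequality is then the chain \<open>-K\<close>, \<open>-C\<close>, \<open>C\<close>, \<open>K\<close>: the asymmetry \<open>R(-K, K)\<close> is at most
  \<open>R(-K, -C) R(-C, C) R(C, K)\<close>, and \<open>R(-K, -C) = R(K, C)\<close> (\<open>minkowski_asymmetry_le\<close>).

  For equality, let \<open>T\<close> be a \<open>d\<close>-simplex with centroid \<open>0\<close> and put \<open>K\<^sub>\<sigma> = T \<inter> (-\<sigma> T)\<close> for
  \<open>1 \<le> \<sigma> \<le> d\<close>. These bodies have asymmetry exactly \<open>\<sigma>\<close>
  (\<open>minkowski_asymmetry_truncated_simplex\<close>), and for \<open>\<sigma> \<le> \<tau>\<close> they satisfy
  \<open>K\<^sub>\<sigma> \<subseteq> K\<^sub>\<tau> \<subseteq> (\<tau> / \<sigma>) K\<^sub>\<sigma>\<close>, because \<open>(\<tau> / \<sigma>) K\<^sub>\<sigma> = (\<tau> / \<sigma>) T \<inter> (-\<tau> T)\<close>. Hence their distance is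
  at most \<open>\<tau> / \<sigma>\<close>, which is also the lower bound given by the inequality.
\<close>

section \<open>Calculus of the circumradius\<close>

lemma circumradius_le:
  assumes "0 \<le> \<rho>" "K \<subseteq> (\<lambda>x. c + \<rho> *\<^sub>R x) ` C"
  shows "circumradius K C \<le> ennreal \<rho>"
  unfolding circumradius_def using assms by (intro Inf_lower) blast

lemma circumradius_greatest:
  assumes "\<And>\<rho> c. 0 \<le> \<rho> \<Longrightarrow> K \<subseteq> (\<lambda>x. c + \<rho> *\<^sub>R x) ` C \<Longrightarrow> z \<le> ennreal \<rho>"
  shows "z \<le> circumradius K C"
  unfolding circumradius_def using assms by (intro Inf_greatest) blast

text \<open>A homothetic copy \<open>c + \<rho> C\<close> has diameter at most \<open>2 \<rho> B\<close> if \<open>C\<close> has norm bound \<open>B\<close>, so two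
  distinct points of \<open>K\<close> force \<open>\<rho>\<close> to stay away from \<open>0\<close>.\<close>

lemma circumradius_pos:
  fixes K C :: "'a::euclidean_space set"
  assumes "bounded C" "K \<noteq> {}" "\<not> is_singleton K"
  shows "0 < circumradius K C"
proof -
  obtain x y where xy: "x \<in> K" "y \<in> K" "x \<noteq> y"
    using assms(2,3) by (metis is_singletonI')
  obtain B where B: "0 < B" "\<And>z. z \<in> C \<Longrightarrow> norm z \<le> B"
    using assms(1) by (auto simp: bounded_pos)
  have "ennreal (dist x y / (2 * B)) \<le> circumradius K C"
  proof (rule circumradius_greatest)
    fix \<rho> c assume \<rho>: "0 \<le> \<rho>" and sub: "K \<subseteq> (\<lambda>x. c + \<rho> *\<^sub>R x) ` C"
    obtain x' y' where "x' \<in> C" "y' \<in> C" "x = c + \<rho> *\<^sub>R x'" "y = c + \<rho> *\<^sub>R y'"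
      using sub xy by blast
    then have "dist x y = \<rho> * dist x' y'"
      using \<rho> by (simp add: dist_norm flip: scaleR_diff_right)
    also have "\<dots> \<le> \<rho> * (2 * B)"
      using B(2)[OF \<open>x' \<in> C\<close>] B(2)[OF \<open>y' \<in> C\<close>] norm_triangle_ineq4[of x' y'] \<rho>
      by (intro mult_left_mono) (auto simp: dist_norm)
    finally show "ennreal (dist x y / (2 * B)) \<le> ennreal \<rho>"
      using B(1) by (intro ennreal_leI) (simp add: field_simps)
  qed
  moreover have "0 < ennreal (dist x y / (2 * B))"
    using xy(3) B(1) by simp
  ultimately show ?thesis by order
qed

lemma ennreal_le_mult_if_divide_le:
  fixes a b c :: ennreal
  assumes "a / b \<le> c" "0 < b" "b \<noteq> \<infinity>"
  shows "a \<le> b * c"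
proof -
  have "a = b * (a / b)"
    using assms(2,3) by (simp add: ennreal_times_divide mult.commute[of b] mult_divide_eq_ennreal)
  also have "\<dots> \<le> b * c" using assms(1) by (rule mult_left_mono) simp
  finally show ?thesis .
qed

text \<open>Homothetic coverings compose, their factors multiply. Positivity excludes the product
  \<open>0 * \<infinity> = 0\<close>, for which the bound can fail: let \<open>B\<close> be a point, \<open>A = B\<close> and \<open>C = {}\<close>.\<close>

lemma circumradius_submult:
  assumes pos: "0 < circumradius A B" "0 < circumradius B C"
  shows "circumradius A C \<le> circumradius A B * circumradius B C"
proof (cases "circumradius B C = \<infinity>")
  case True
  then show ?thesis using pos(1) by (simp add: ennreal_mult_top)
next
  case False
  have "circumradius A C / circumradius B C \<le> circumradius A B"
  proof (rule circumradius_greatest)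
    fix \<alpha> a assume \<alpha>: "0 \<le> \<alpha>" and AB: "A \<subseteq> (\<lambda>x. a + \<alpha> *\<^sub>R x) ` B"
    have "0 < ennreal \<alpha>"
      using circumradius_le[OF \<alpha> AB] pos(1) by order
    have "circumradius A C / ennreal \<alpha> \<le> circumradius B C"
    proof (rule circumradius_greatest)
      fix \<beta> b assume \<beta>: "0 \<le> \<beta>" and BC: "B \<subseteq> (\<lambda>x. b + \<beta> *\<^sub>R x) ` C"
      have "A \<subseteq> (\<lambda>x. a + \<alpha> *\<^sub>R x) ` (\<lambda>x. b + \<beta> *\<^sub>R x) ` C"
        using AB BC by blast
      then have "A \<subseteq> (\<lambda>x. (a + \<alpha> *\<^sub>R b) + (\<alpha> * \<beta>) *\<^sub>R x) ` C"
        by (simp add: image_image scaleR_add_right add.assoc)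
      then have "circumradius A C \<le> ennreal (\<alpha> * \<beta>)"
        using \<alpha> \<beta> by (intro circumradius_le) auto
      then show "circumradius A C / ennreal \<alpha> \<le> ennreal \<beta>"
        using \<alpha> \<open>0 < ennreal \<alpha>\<close> by (intro divide_le_posI_ennreal) (auto simp: ennreal_mult' mult.commute)
    qed
    then have "circumradius A C \<le> ennreal \<alpha> * circumradius B C"
      using \<open>0 < ennreal \<alpha>\<close> by (intro ennreal_le_mult_if_divide_le) auto
    then show "circumradius A C / circumradius B C \<le> ennreal \<alpha>"
      using pos(2) by (intro divide_le_posI_ennreal) (auto simp: mult.commute)
  qed
  then show ?thesis
    using False pos(2) by (subst mult.commute, intro ennreal_le_mult_if_divide_le) auto
qed

lemma circumradius_uminus:
  "circumradius (uminus ` K) (uminus ` C) = circumradius K C"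
proof -
  have le: "circumradius (uminus ` A) (uminus ` B) \<le> circumradius A B"
    for A B :: "'a set"
  proof (rule circumradius_greatest)
    fix \<rho> c assume \<rho>: "0 \<le> \<rho>" and sub: "A \<subseteq> (\<lambda>x. c + \<rho> *\<^sub>R x) ` B"
    have "uminus ` A \<subseteq> uminus ` (\<lambda>x. c + \<rho> *\<^sub>R x) ` B"
      using sub by (rule image_mono)
    also have "\<dots> = (\<lambda>x. - c + \<rho> *\<^sub>R x) ` uminus ` B"
      by (auto simp: image_image)
    finally show "circumradius (uminus ` A) (uminus ` B) \<le> ennreal \<rho>"
      using \<rho> by (intro circumradius_le)
  qed
  show ?thesis
    using le[of K C] le[of "uminus ` K" "uminus ` C"] by (simp add: image_image)
qed

text \<open>\<open>R = R(K, K)\<close> satisfies \<open>R \<le> R\<^sup>2\<close> by submultiplicativity, and \<open>0 < R \<le> 1\<close>; dividing by \<open>R\<close> gives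
  the claim.\<close>

lemma circumradius_self_ge_1:
  fixes K :: "'a::euclidean_space set"
  assumes "bounded K" "K \<noteq> {}" "\<not> is_singleton K"
  shows "1 \<le> circumradius K K"
proof -
  let ?R = "circumradius K K"
  have pos: "0 < ?R" using assms by (intro circumradius_pos)
  have "?R \<le> 1" using circumradius_le[of 1 K 0 K] by simp
  then have fin: "?R \<noteq> \<infinity>" by (auto simp: top_unique)
  have "?R \<le> ?R * ?R" using pos by (intro circumradius_submult)
  then have "?R / ?R \<le> ?R"
    using pos by (intro divide_le_posI_ennreal)
  then show ?thesis using pos fin by (simp add: less_top)
qed

section \<open>The ratio of circumradius and inradius\<close>

lemma ennreal_inverse_inverse: "inverse (inverse x) = (x :: ennreal)"
proof (cases x)
  case (real r)
  then show ?thesis by (cases "r = 0") (auto simp: inverse_ennreal)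
qed simp

lemma ennreal_inverse_antimono: "a \<le> b \<Longrightarrow> inverse b \<le> inverse (a :: ennreal)"
  by (simp add: less_eq_ennreal.rep_eq inverse_ennreal.rep_eq ereal_inverse_antimono enn2ereal_nonneg)

text \<open>For \<open>\<rho> > 0\<close>, the inclusion \<open>c + \<rho> C \<subseteq> K\<close> is the same as
  \<open>C \<subseteq> - c / \<rho> + (1 / \<rho>) K\<close>. The factor \<open>\<rho> = 0\<close> never raises the
  supremum, and it is not admissible for covering \<open>C\<close>, which has more than one point.\<close>

lemma inradius_eq_inverse_circumradius:
  fixes K C :: "'a::euclidean_space set"
  assumes "bounded K" "C \<noteq> {}" "\<not> is_singleton C"
  shows "inradius K C = inverse (circumradius C K)"
proof (rule antisym)
  have pos: "0 < circumradius C K" using assms by (intro circumradius_pos)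
  show "inradius K C \<le> inverse (circumradius C K)"
    unfolding inradius_def
  proof (rule Sup_least, clarify)
    fix \<rho> c assume "0 \<le> \<rho>" and sub: "(\<lambda>x. c + \<rho> *\<^sub>R x) ` C \<subseteq> K"
    show "ennreal \<rho> \<le> inverse (circumradius C K)"
    proof (cases "\<rho> = 0")
      case False
      then have \<rho>: "0 < \<rho>" using \<open>0 \<le> \<rho>\<close> by simp
      have "C = (\<lambda>x. - (1 / \<rho>) *\<^sub>R c + (1 / \<rho>) *\<^sub>R x) ` (\<lambda>x. c + \<rho> *\<^sub>R x) ` C"
        using \<rho> by (simp add: image_image scaleR_add_right)
      also have "\<dots> \<subseteq> (\<lambda>x. - (1 / \<rho>) *\<^sub>R c + (1 / \<rho>) *\<^sub>R x) ` K"
        using sub by (rule image_mono)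
      finally have "circumradius C K \<le> ennreal (1 / \<rho>)"
        using \<rho> circumradius_le[of "1 / \<rho>" C "- (1 / \<rho>) *\<^sub>R c" K] by simp
      then have "inverse (ennreal (1 / \<rho>)) \<le> inverse (circumradius C K)"
        by (rule ennreal_inverse_antimono)
      then show ?thesis using \<rho> by (simp add: inverse_ennreal)
    qed simp
  qed
  have "inverse (inradius K C) \<le> circumradius C K"
  proof (rule circumradius_greatest)
    fix \<rho> c assume "0 \<le> \<rho>" and sub: "C \<subseteq> (\<lambda>x. c + \<rho> *\<^sub>R x) ` K"
    have "0 < ennreal \<rho>"
      using circumradius_le[OF \<open>0 \<le> \<rho>\<close> sub] pos by order
    then have \<rho>: "0 < \<rho>" by simp
    have "(\<lambda>x. - (1 / \<rho>) *\<^sub>R c + (1 / \<rho>) *\<^sub>R x) ` C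
        \<subseteq> (\<lambda>x. - (1 / \<rho>) *\<^sub>R c + (1 / \<rho>) *\<^sub>R x) ` (\<lambda>x. c + \<rho> *\<^sub>R x) ` K"
      using sub by (rule image_mono)
    also have "\<dots> = K"
      using \<rho> by (simp add: image_image scaleR_add_right)
    finally have "\<exists>c. (\<lambda>x. c + (1 / \<rho>) *\<^sub>R x) ` C \<subseteq> K" by blast
    then have "ennreal (1 / \<rho>) \<le> inradius K C"
      unfolding inradius_def using \<rho>
      by (intro Sup_upper CollectI exI[of _ "1 / \<rho>"]) auto
    then have "inverse (inradius K C) \<le> inverse (ennreal (1 / \<rho>))"
      by (rule ennreal_inverse_antimono)
    then show "inverse (inradius K C) \<le> ennreal \<rho>"
      using \<rho> by (simp add: inverse_ennreal)
  qed
  then have "inverse (circumradius C K) \<le> inverse (inverse (inradius K C))"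
    by (rule ennreal_inverse_antimono)
  then show "inverse (circumradius C K) \<le> inradius K C" by (simp add: ennreal_inverse_inverse)
qed

text \<open>Both circumradii are positive, so the quotient by \<open>1 / R(C, K)\<close> is never \<open>0 / 0\<close> or \<open>\<infinity> / \<infinity>\<close>.\<close>

lemma ext_ratio_circumradius_inradius:
  fixes K C :: "'a::euclidean_space set"
  assumes "bounded K" "K \<noteq> {}" "\<not> is_singleton K"
    and "bounded C" "C \<noteq> {}" "\<not> is_singleton C"
  shows "ext_ratio (circumradius K C) (inradius K C) = circumradius K C * circumradius C K"
proof -
  have "0 < circumradius K C" "0 < circumradius C K"
    using assms by (auto intro: circumradius_pos)
  then show ?thesis
    using inradius_eq_inverse_circumradius[of K C] assms
    by (auto simp: ext_ratio_def divide_ennreal_def ennreal_inverse_inverse)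
qed

text \<open>Cover \<open>-K\<close> by a copy of \<open>-C\<close>, that by a copy of \<open>C\<close>, and that by a copy of \<open>K\<close>.\<close>

lemma minkowski_asymmetry_le:
  fixes K C :: "'a::euclidean_space set"
  assumes "bounded K" "K \<noteq> {}" "\<not> is_singleton K"
    and "bounded C" "C \<noteq> {}" "\<not> is_singleton C"
  shows "minkowski_asymmetry K
    \<le> circumradius K C * circumradius C K * minkowski_asymmetry C"
proof -
  have neg: "bounded (uminus ` A) \<and> uminus ` A \<noteq> {} \<and> \<not> is_singleton (uminus ` A)"
    if "bounded A" "A \<noteq> {}" "\<not> is_singleton A" for A :: "'a set"
  proof -
    have "\<not> is_singleton (uminus ` A)"
      using that(3) by (simp add: is_singleton_altdef card_image)
    then show ?thesis using that by (simp add: bounded_uminus)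
  qed
  have pos: "0 < circumradius A B"
    if "A \<in> {K, C, uminus ` K, uminus ` C}" "B \<in> {K, C, uminus ` K, uminus ` C}" for A B
    using that neg[of K] neg[of C] assms by (auto intro: circumradius_pos)
  have "circumradius (uminus ` K) K \<le> circumradius (uminus ` K) C * circumradius C K"
    by (intro circumradius_submult pos) auto
  also have "\<dots> \<le> (circumradius (uminus ` K) (uminus ` C) * circumradius (uminus ` C) C)
      * circumradius C K"
    by (intro mult_right_mono circumradius_submult pos) auto
  finally show ?thesis
    by (simp add: minkowski_asymmetry_def circumradius_uminus ac_simps)
qed

text \<open>The assumption \<open>1 \<le> q\<close> covers the forms \<open>0 / 0\<close> and \<open>\<infinity> / \<infinity>\<close>, whose ratio is \<open>1\<close>. With a finite
  \<open>q\<close>, having the bound in both directions makes \<open>a\<close> and \<open>b\<close> vanish together.\<close>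

lemma ext_ratio_le:
  assumes "1 \<le> q" "a \<le> q * b" "b \<le> q * a"
  shows "ext_ratio a b \<le> q"
proof (cases "q = \<infinity> \<or> (a = 0 \<and> b = 0) \<or> (a = \<infinity> \<and> b = \<infinity>)")
  case True
  then show ?thesis using assms(1) by (auto simp: ext_ratio_def)
next
  case False
  then have "b \<noteq> 0" using assms(2) by auto
  then have "a / b \<le> q" using assms(2) by (intro divide_le_posI_ennreal) (auto simp: zero_less_iff_neq_zero mult.commute)
  then show ?thesis using False by (auto simp: ext_ratio_def)
qed

text \<open>The radius ratio \<open>q = R(K, C) R(C, K)\<close> is symmetric in \<open>K\<close> and \<open>C\<close>, so
  \<open>minkowski_asymmetry_le\<close> compares the two asymmetries in both directions up to the same
  factor \<open>q\<close>.\<close>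

lemma asymmetry_ratio_le_radius_ratio:
  fixes K C :: "'a::euclidean_space set"
  assumes K: "bounded K" "K \<noteq> {}" "\<not> is_singleton K"
    and C: "bounded C" "C \<noteq> {}" "\<not> is_singleton C"
  shows "max (ext_ratio (minkowski_asymmetry K) (minkowski_asymmetry C))
             (ext_ratio (minkowski_asymmetry C) (minkowski_asymmetry K))
    \<le> ext_ratio (circumradius K C) (inradius K C)"
proof -
  have "1 \<le> circumradius K K" using K by (rule circumradius_self_ge_1)
  also have "\<dots> \<le> circumradius K C * circumradius C K"
    using K C by (intro circumradius_submult circumradius_pos)
  finally show ?thesis
    using minkowski_asymmetry_le[OF K C] minkowski_asymmetry_le[OF C K]
    unfolding ext_ratio_circumradius_inradius[OF K C]
    by (intro max.boundedI ext_ratio_le) (auto simp: mult.commute)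
qed

section \<open>Truncated simplices\<close>

text \<open>The outer normals of the simplex \<open>T = {x. \<forall>u\<in>simplex_normals. u \<bullet> x \<le> 1}\<close>. They sum to \<open>0\<close>, so
  \<open>0\<close> is the centroid of \<open>T\<close>; \<open>T\<close> is a regular simplex only up to a linear map, which,
  applied to all bodies at once, preserves circumradii and asymmetries.\<close>

definition simplex_normals :: "'a::euclidean_space set" where
  "simplex_normals = insert (- One) Basis"

text \<open>For \<open>\<sigma> > 0\<close> this is \<open>T \<inter> (-\<sigma> T)\<close>, expressed by the inequalities of the two simplices.\<close>

definition truncated_simplex :: "real \<Rightarrow> 'a::euclidean_space set" where
  "truncated_simplex \<sigma> = {x. \<forall>u\<in>simplex_normals. - \<sigma> \<le> u \<bullet> x \<and> u \<bullet> x \<le> 1}"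

lemma neg_One_notin_Basis: "- One \<notin> (Basis :: 'a::euclidean_space set)"
proof
  assume *: "- One \<in> (Basis :: 'a set)"
  have "One \<bullet> (- One :: 'a) = 1"
    using inner_sum_left_Basis[OF *, of "\<lambda>_. 1"] by simp
  moreover have "One \<bullet> (- One :: 'a) \<le> 0" by (simp only: inner_minus_right) simp
  ultimately show False by simp
qed

lemma card_simplex_normals_pos: "0 < card (simplex_normals :: 'a::euclidean_space set)"
  by (simp add: simplex_normals_def card_gt_0_iff)

lemma sum_simplex_normals: "\<Sum>simplex_normals = (0 :: 'a::euclidean_space)"
  using neg_One_notin_Basis[where 'a = 'a] by (simp add: simplex_normals_def)

text \<open>The point \<open>p\<close> is the centroid of the facet of \<open>T\<close> with normal \<open>u\<close>. The opposite vertex is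
  \<open>- d p\<close>, and \<open>- \<sigma> p\<close> moves towards it until the truncating facet opposite to \<open>u\<close> is
  reached.\<close>

lemma facet_centroid_exists:
  fixes u :: "'a::euclidean_space"
  assumes "u \<in> simplex_normals"
  obtains p where "u \<bullet> p = 1"
    "\<And>v. v \<in> simplex_normals \<Longrightarrow> v \<noteq> u \<Longrightarrow> v \<bullet> p = - 1 / DIM('a)"
proof -
  have One: "(One :: 'a) \<bullet> One = DIM('a)"
    by (simp add: inner_sum_right)
  have One_b: "b \<bullet> One = 1" "One \<bullet> b = 1" if "b \<in> Basis" for b :: 'a
    using that by (auto simp: inner_commute[of b])
  show thesis
  proof (cases "u = - One")
    case True
    show thesis
      by (rule that[of "(- 1 / DIM('a)) *\<^sub>R One"])
        (auto simp: True One One_b simplex_normals_def)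
  next
    case False
    then have u: "u \<in> Basis" using assms by (simp add: simplex_normals_def)
    show thesis
      by (rule that[of "u + (1 / DIM('a)) *\<^sub>R (u - One)"])
        (use u in \<open>auto simp: One One_b inner_Basis simplex_normals_def inner_simps field_simps\<close>)
  qed
qed

lemma convex_body_truncated_simplex:
  assumes "0 \<le> \<sigma>"
  shows "convex_body (truncated_simplex \<sigma> :: 'a::euclidean_space set)"
proof -
  have eq: "truncated_simplex \<sigma> =
      (\<Inter>u\<in>simplex_normals. {x :: 'a. u \<bullet> x \<ge> - \<sigma>} \<inter> {x. u \<bullet> x \<le> 1})"
    by (auto simp: truncated_simplex_def)
  have "convex (truncated_simplex \<sigma> :: 'a set)"
    unfolding eq by (intro convex_INT convex_Int convex_halfspace_ge convex_halfspace_le)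
  moreover have "closed (truncated_simplex \<sigma> :: 'a set)"
    unfolding eq by (intro closed_INT ballI closed_Int closed_halfspace_ge closed_halfspace_le)
  moreover have "bounded (truncated_simplex \<sigma> :: 'a set)"
  proof (rule bounded_subset[OF bounded_cbox])
    show "truncated_simplex \<sigma> \<subseteq> cbox ((- \<sigma>) *\<^sub>R One) (One :: 'a)"
    proof
      fix x :: 'a assume "x \<in> truncated_simplex \<sigma>"
      then have "- \<sigma> \<le> x \<bullet> b \<and> x \<bullet> b \<le> 1" if "b \<in> Basis" for b
        using that by (simp add: truncated_simplex_def simplex_normals_def inner_commute)
      then show "x \<in> cbox ((- \<sigma>) *\<^sub>R One) One"
        by (simp add: mem_box)
    qed
  qed
  moreover have "0 \<in> (truncated_simplex \<sigma> :: 'a set)"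
    using assms by (simp add: truncated_simplex_def)
  ultimately show ?thesis
    by (auto simp: convex_body_def compact_eq_bounded_closed)
qed

text \<open>The upper bound is \<open>- K\<^sub>\<sigma> = (-T) \<inter> \<sigma> T \<subseteq> (-\<sigma>\<^sup>2 T) \<inter> \<sigma> T = \<sigma> K\<^sub>\<sigma>\<close>. For the lower bound, compare
  support functions in the directions \<open>u\<close> of the facets of \<open>T\<close>: \<open>- K\<^sub>\<sigma>\<close> reaches \<open>\<sigma>\<close> in each of
  them, while \<open>c + \<rho> K\<^sub>\<sigma>\<close> reaches at most \<open>u \<bullet> c + \<rho>\<close>. Since the normals sum to \<open>0\<close>, adding up all
  \<open>\<sigma> \<le> u \<bullet> c + \<rho>\<close> eliminates the unknown translation \<open>c\<close>.\<close>

lemma minkowski_asymmetry_truncated_simplex: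
  fixes \<sigma> :: real
  assumes \<sigma>: "1 \<le> \<sigma>" "\<sigma> \<le> DIM('a)"
  shows "minkowski_asymmetry (truncated_simplex \<sigma> :: 'a::euclidean_space set) = ennreal \<sigma>"
    (is "minkowski_asymmetry ?K = _")
proof (rule antisym)
  have "uminus ` ?K \<subseteq> (\<lambda>x. 0 + \<sigma> *\<^sub>R x) ` ?K"
  proof clarify
    fix x assume x: "x \<in> ?K"
    have "- (1 / \<sigma>) *\<^sub>R x \<in> ?K"
      unfolding truncated_simplex_def
    proof clarify
      fix u :: 'a assume "u \<in> simplex_normals"
      then have "- \<sigma> \<le> u \<bullet> x" "u \<bullet> x \<le> 1" using x by (auto simp: truncated_simplex_def)
      moreover have "1 \<le> \<sigma> * \<sigma>" using \<sigma>(1) mult_mono[of 1 \<sigma> 1 \<sigma>] by simp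
      ultimately show "- \<sigma> \<le> u \<bullet> - (1 / \<sigma>) *\<^sub>R x \<and> u \<bullet> - (1 / \<sigma>) *\<^sub>R x \<le> 1"
        using \<sigma>(1) by (auto simp: field_simps)
    qed
    then show "- x \<in> (\<lambda>x. 0 + \<sigma> *\<^sub>R x) ` ?K"
      using \<sigma>(1) by (intro image_eqI) auto
  qed
  then show "minkowski_asymmetry ?K \<le> ennreal \<sigma>"
    unfolding minkowski_asymmetry_def using \<sigma>(1) by (intro circumradius_le[of \<sigma> _ 0]) auto
  show "ennreal \<sigma> \<le> minkowski_asymmetry ?K"
    unfolding minkowski_asymmetry_def
  proof (rule circumradius_greatest)
    fix \<rho> c assume \<rho>: "0 \<le> \<rho>" and sub: "uminus ` ?K \<subseteq> (\<lambda>x. c + \<rho> *\<^sub>R x) ` ?K"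
    have bound: "\<sigma> - \<rho> \<le> u \<bullet> c" if u: "u \<in> simplex_normals" for u
    proof -
      obtain p where p: "u \<bullet> p = 1"
        "\<And>v. v \<in> simplex_normals \<Longrightarrow> v \<noteq> u \<Longrightarrow> v \<bullet> p = - 1 / DIM('a)"
        by (rule facet_centroid_exists[OF u]) blast
      \<comment> \<open>In the other normal directions \<open>- \<sigma> p\<close> has value \<open>\<sigma> / d\<close>; this is where \<open>\<sigma> \<le> d\<close> enters.\<close>
      have "(- \<sigma>) *\<^sub>R p \<in> ?K"
        unfolding truncated_simplex_def
      proof clarify
        fix v :: 'a assume v: "v \<in> simplex_normals"
        show "- \<sigma> \<le> v \<bullet> (- \<sigma>) *\<^sub>R p \<and> v \<bullet> (- \<sigma>) *\<^sub>R p \<le> 1"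
        proof (cases "v = u")
          case True
          then show ?thesis using p(1) \<sigma> by simp
        next
          case False
          then have "v \<bullet> (- \<sigma>) *\<^sub>R p = \<sigma> / DIM('a)" using p(2)[OF v] by simp
          moreover have "0 \<le> \<sigma> / DIM('a)" "\<sigma> / DIM('a) \<le> 1" using \<sigma> by auto
          ultimately show ?thesis using \<sigma>(1) by linarith
        qed
      qed
      then have "- ((- \<sigma>) *\<^sub>R p) \<in> (\<lambda>x. c + \<rho> *\<^sub>R x) ` ?K"
        using sub by blast
      then obtain x where x: "x \<in> ?K" "\<sigma> *\<^sub>R p = c + \<rho> *\<^sub>R x"
        by auto
      have "\<sigma> = u \<bullet> (\<sigma> *\<^sub>R p)" using p(1) by simp
      also have "\<dots> = u \<bullet> c + \<rho> * (u \<bullet> x)" by (simp add: x(2) inner_add_right)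
      also have "\<dots> \<le> u \<bullet> c + \<rho> * 1"
        using x(1) u \<rho> by (intro add_left_mono mult_left_mono) (auto simp: truncated_simplex_def)
      finally show ?thesis by simp
    qed
    have "card (simplex_normals :: 'a set) * (\<sigma> - \<rho>) \<le> (\<Sum>u\<in>simplex_normals. u \<bullet> c)"
      using sum_mono[of simplex_normals "\<lambda>_. \<sigma> - \<rho>", OF bound] by simp
    also have "\<dots> = 0"
      by (simp add: sum_simplex_normals flip: inner_sum_left)
    finally have "\<sigma> \<le> \<rho>"
      using card_simplex_normals_pos[where 'a = 'a] by (auto simp: mult_le_0_iff)
    then show "ennreal \<sigma> \<le> ennreal \<rho>" by (rule ennreal_leI)
  qed
qed

text \<open>A point would have asymmetry \<open>0\<close>.\<close>

lemma not_is_singleton_truncated_simplex: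
  fixes \<sigma> :: real
  assumes \<sigma>: "1 \<le> \<sigma>" "\<sigma> \<le> DIM('a)"
  shows "\<not> is_singleton (truncated_simplex \<sigma> :: 'a::euclidean_space set)"
proof
  assume "is_singleton (truncated_simplex \<sigma> :: 'a set)"
  then obtain a :: 'a where a: "truncated_simplex \<sigma> = {a}" by (rule is_singletonE)
  have "minkowski_asymmetry {a} \<le> ennreal 0"
    unfolding minkowski_asymmetry_def by (intro circumradius_le[of _ _ "- a"]) auto
  then show False
    using minkowski_asymmetry_truncated_simplex[OF \<sigma>] \<sigma>(1) by (simp add: a)
qed

text \<open>A factor \<open>q\<close> suffices if \<open>T \<subseteq> q T\<close> and \<open>\<tau> T \<subseteq> q \<sigma> T\<close>, that is, \<open>q \<ge> 1\<close> and
  \<open>q \<ge> \<tau> / \<sigma>\<close>.\<close>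

lemma circumradius_truncated_simplex_le:
  assumes "1 \<le> \<sigma>" "1 \<le> \<tau>"
  shows "circumradius (truncated_simplex \<tau> :: 'a::euclidean_space set) (truncated_simplex \<sigma>)
    \<le> ennreal (max 1 (\<tau> / \<sigma>))"
proof (rule circumradius_le)
  define q where "q = max 1 (\<tau> / \<sigma>)"
  have q: "1 \<le> q" "\<tau> \<le> q * \<sigma>"
    using assms by (auto simp: q_def max_def field_simps)
  show "truncated_simplex \<tau> \<subseteq> (\<lambda>x :: 'a. 0 + q *\<^sub>R x) ` truncated_simplex \<sigma>"
  proof
    fix x :: 'a assume x: "x \<in> truncated_simplex \<tau>"
    have "(1 / q) *\<^sub>R x \<in> truncated_simplex \<sigma>"
      unfolding truncated_simplex_def
    proof clarify
      fix u :: 'a assume "u \<in> simplex_normals"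
      then have "- \<tau> \<le> u \<bullet> x" "u \<bullet> x \<le> 1" using x by (auto simp: truncated_simplex_def)
      then show "- \<sigma> \<le> u \<bullet> (1 / q) *\<^sub>R x \<and> u \<bullet> (1 / q) *\<^sub>R x \<le> 1"
        using q by (auto simp: field_simps)
    qed
    then show "x \<in> (\<lambda>x. 0 + q *\<^sub>R x) ` truncated_simplex \<sigma>"
      using q by (intro image_eqI[of _ _ "(1 / q) *\<^sub>R x"]) auto
  qed
qed auto

text \<open>One of the two covering factors is \<open>1\<close> and the other one is the larger of \<open>\<sigma> / \<tau>\<close> and
  \<open>\<tau> / \<sigma>\<close>, so their product meets the general lower bound.\<close>

lemma radius_ratio_truncated_simplex:
  fixes \<sigma> \<tau> :: real
  assumes \<sigma>: "1 \<le> \<sigma>" "\<sigma> \<le> DIM('a)" and \<tau>: "1 \<le> \<tau>" "\<tau> \<le> DIM('a)"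
  defines "K \<equiv> truncated_simplex \<sigma> :: 'a::euclidean_space set"
    and "C \<equiv> truncated_simplex \<tau> :: 'a set"
  shows "ext_ratio (circumradius K C) (inradius K C) =
    max (ext_ratio (minkowski_asymmetry K) (minkowski_asymmetry C))
        (ext_ratio (minkowski_asymmetry C) (minkowski_asymmetry K))"
proof (rule antisym)
  have K: "bounded K" "K \<noteq> {}" "\<not> is_singleton K"
    using convex_body_truncated_simplex[of \<sigma>] not_is_singleton_truncated_simplex[OF \<sigma>] \<sigma>(1)
    by (auto simp: K_def convex_body_def intro: compact_imp_bounded)
  have C: "bounded C" "C \<noteq> {}" "\<not> is_singleton C"
    using convex_body_truncated_simplex[of \<tau>] not_is_singleton_truncated_simplex[OF \<tau>] \<tau>(1)
    by (auto simp: C_def convex_body_def intro: compact_imp_bounded)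
  show "max (ext_ratio (minkowski_asymmetry K) (minkowski_asymmetry C))
        (ext_ratio (minkowski_asymmetry C) (minkowski_asymmetry K))
      \<le> ext_ratio (circumradius K C) (inradius K C)"
    using K C by (rule asymmetry_ratio_le_radius_ratio)
  have ratio: "ext_ratio (ennreal a) (ennreal b) = ennreal (a / b)" if "1 \<le> a" "1 \<le> b" for a b
    using that by (simp add: ext_ratio_def divide_ennreal)
  have "ext_ratio (circumradius K C) (inradius K C) = circumradius K C * circumradius C K"
    using K C by (rule ext_ratio_circumradius_inradius)
  also have "\<dots> \<le> ennreal (max 1 (\<sigma> / \<tau>)) * ennreal (max 1 (\<tau> / \<sigma>))"
    unfolding K_def C_def using \<sigma>(1) \<tau>(1)
    by (intro mult_mono circumradius_truncated_simplex_le) auto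
  also have "\<dots> = ennreal (max 1 (\<sigma> / \<tau>) * max 1 (\<tau> / \<sigma>))"
    by (simp add: ennreal_mult)
  also have "max 1 (\<sigma> / \<tau>) * max 1 (\<tau> / \<sigma>) = max (\<sigma> / \<tau>) (\<tau> / \<sigma>)"
  proof (cases "\<sigma> \<le> \<tau>")
    case True
    then have "\<sigma> / \<tau> \<le> 1" "1 \<le> \<tau> / \<sigma>" using \<sigma>(1) \<tau>(1) by auto
    then show ?thesis by simp
  next
    case False
    then have "1 \<le> \<sigma> / \<tau>" "\<tau> / \<sigma> \<le> 1" using \<sigma>(1) \<tau>(1) by auto
    then show ?thesis by simp
  qed
  also have "ennreal \<dots> = max (ennreal (\<sigma> / \<tau>)) (ennreal (\<tau> / \<sigma>))"
    using \<sigma>(1) \<tau>(1) by (auto simp: max_def)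
  finally show "ext_ratio (circumradius K C) (inradius K C)
      \<le> max (ext_ratio (minkowski_asymmetry K) (minkowski_asymmetry C))
            (ext_ratio (minkowski_asymmetry C) (minkowski_asymmetry K))"
    using \<sigma> \<tau> by (simp add: K_def C_def minkowski_asymmetry_truncated_simplex ratio)
qed

section \<open>The inequality and its sharpness\<close>

theorem theorem6p1:
  "(\<forall>K C :: 'a::euclidean_space set.
      convex_body K \<and> convex_body C \<and> \<not> is_singleton K \<and> \<not> is_singleton C \<longrightarrow>
      ext_ratio (circumradius K C) (inradius K C) \<ge>
        max (ext_ratio (minkowski_asymmetry K) (minkowski_asymmetry C))
            (ext_ratio (minkowski_asymmetry C) (minkowski_asymmetry K))) \<and>
   (\<forall>\<sigma>\<^sub>K \<in> {1..real DIM('a)}. \<forall>\<sigma>\<^sub>C \<in> {1..real DIM('a)}.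
      \<exists>K C :: 'a set. convex_body K \<and> convex_body C \<and>
        minkowski_asymmetry K = ennreal \<sigma>\<^sub>K \<and> minkowski_asymmetry C = ennreal \<sigma>\<^sub>C \<and>
        ext_ratio (circumradius K C) (inradius K C) =
          max (ext_ratio (minkowski_asymmetry K) (minkowski_asymmetry C))
              (ext_ratio (minkowski_asymmetry C) (minkowski_asymmetry K)))"
proof (intro conjI allI ballI impI)
  fix K C :: "'a set"
  assume "convex_body K \<and> convex_body C \<and> \<not> is_singleton K \<and> \<not> is_singleton C"
  then show "max (ext_ratio (minkowski_asymmetry K) (minkowski_asymmetry C))
      (ext_ratio (minkowski_asymmetry C) (minkowski_asymmetry K))
    \<le> ext_ratio (circumradius K C) (inradius K C)"
    by (intro asymmetry_ratio_le_radius_ratio) (auto simp: convex_body_def intro: compact_imp_bounded)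
next
  fix \<sigma>\<^sub>K \<sigma>\<^sub>C :: real
  assume "\<sigma>\<^sub>K \<in> {1..real DIM('a)}" "\<sigma>\<^sub>C \<in> {1..real DIM('a)}"
  then have \<sigma>: "1 \<le> \<sigma>\<^sub>K" "\<sigma>\<^sub>K \<le> DIM('a)" "1 \<le> \<sigma>\<^sub>C" "\<sigma>\<^sub>C \<le> DIM('a)" by auto
  let ?K = "truncated_simplex \<sigma>\<^sub>K :: 'a set" and ?C = "truncated_simplex \<sigma>\<^sub>C :: 'a set"
  have "convex_body ?K" "convex_body ?C"
    using \<sigma> by (auto intro: convex_body_truncated_simplex)
  with minkowski_asymmetry_truncated_simplex[OF \<sigma>(1,2)]
    minkowski_asymmetry_truncated_simplex[OF \<sigma>(3,4)] radius_ratio_truncated_simplex[OF \<sigma>]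
  show "\<exists>K C :: 'a set. convex_body K \<and> convex_body C \<and>
      minkowski_asymmetry K = ennreal \<sigma>\<^sub>K \<and> minkowski_asymmetry C = ennreal \<sigma>\<^sub>C \<and>
      ext_ratio (circumradius K C) (inradius K C) =
        max (ext_ratio (minkowski_asymmetry K) (minkowski_asymmetry C))
            (ext_ratio (minkowski_asymmetry C) (minkowski_asymmetry K))"
    by blast
qed

end
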